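(* For every integer $r\geq 3$ there exists $n_0$ such that for all integers $n>n_0$ the following holds. For every set $A\subseteq [n]$ with $|A|\geq (1-r^{-3})n$, the number of rainbow sum-free $r$-colorings of $A$ satisfies $$g(A,r)\leq \binom{r}{2}\cdot 2^{|A|}+2^{-\frac{n}{26\log_2 n}}\,2^n.$$
   Context: $[n]=\{1,\dots,n\}$. An $r$-coloring of a set $A$ of positive integers is a map $f:A\to[r]$. A rainbow sum in a colored set is a triple of three distinct elements $x,y,z$ with $x+y=z$ that receive three different colors. An $r$-coloring is rainbow sum-free if it contains no rainbow sum. $g(A,r)$ denotes the number of rainbow sum-free $r$-colorings of $A$. *)

theory Defs
  imports Complex_Main "HOL-Library.FuncSet"
begin

(* Colorings are extensional functions (value undefined outside A), so that
   distinct elements of this set are distinct maps A -> [r]. *)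
definition colorings :: "nat set \<Rightarrow> nat \<Rightarrow> (nat \<Rightarrow> nat) set" where
  "colorings A r = A \<rightarrow>\<^sub>E {1..r}"

definition rainbow_sum :: "nat set \<Rightarrow> (nat \<Rightarrow> nat) \<Rightarrow> nat \<Rightarrow> nat \<Rightarrow> nat \<Rightarrow> bool" where
  "rainbow_sum A f x y z \<longleftrightarrow>
     x \<in> A \<and> y \<in> A \<and> z \<in> A \<and> x \<noteq> y \<and> y \<noteq> z \<and> x \<noteq> z \<and> x + y = z \<and>
     f x \<noteq> f y \<and> f y \<noteq> f z \<and> f x \<noteq> f z"

definition rainbow_sum_free :: "nat set \<Rightarrow> (nat \<Rightarrow> nat) \<Rightarrow> bool" where
  "rainbow_sum_free A f \<longleftrightarrow> (\<nexists>x y z. rainbow_sum A f x y z)"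

definition g :: "nat set \<Rightarrow> nat \<Rightarrow> nat" where
  "g A r = card {f \<in> colorings A r. rainbow_sum_free A f}"

end

theory Submission
  imports Defs "HOL-Real_Asymp.Real_Asymp"
begin

text \<open>
  If \<open>u, y, z \<in> A\<close> with \<open>z = \<bar>y - u\<bar>\<close> and \<open>f y \<noteq> f z\<close>, then \<open>f u \<in> {f y, f z}\<close>.
  Call \<open>u\<close> stable for a colour \<open>d\<close> if for almost all \<open>y\<close> either both or none of \<open>y\<close> and
  \<open>\<bar>y - u\<bar>\<close> have colour \<open>d\<close>.

  If three colours have at most \<open>3 n / r^3\<close> stable elements each, then a greedily chosen hitting set \<open>S\<close>
  of size \<open>o(n / log n)\<close> contains, for every other element \<open>u\<close> and each of the three colours \<open>d\<close>, a pair
  \<open>{y, \<bar>y - u\<bar>}\<close> in which exactly one element has colour \<open>d\<close>. These pairs determine \<open>f u\<close>, so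
  only \<open>2^o(n) * r^(9 n / r^3) \<le> 2^(2 n / 3 + o(n))\<close> such colourings exist.

  Otherwise all colours but two, \<open>a\<close> and \<open>b\<close>, have more than \<open>3 n / r^3\<close> stable elements. As at most
  \<open>n / r^3\<close> elements are missing from \<open>A\<close>, every \<open>y\<close> has many stable \<open>u\<close> with \<open>\<bar>y - u\<bar> \<in> A\<close>, and a
  second hitting set shows that there are only \<open>2^o(n)\<close> possible colour classes for such a colour.
  Let \<open>W\<close> be the set of elements coloured neither \<open>a\<close> nor \<open>b\<close>, and \<open>x \<in> W\<close>. Then
  \<open>f y = f \<bar>y - x\<bar>\<close> on \<open>A - W\<close>, which leaves at most \<open>2^(5 n / 6)\<close> choices for \<open>f\<close> on \<open>A - W\<close>.
\<close>

section \<open>Counting\<close>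

lemma card_le_card_times_fibre:
  assumes "finite C" "finite D" "h ` C \<subseteq> D"
    and "\<And>d. d \<in> D \<Longrightarrow> card {c \<in> C. h c = d} \<le> M"
  shows "card C \<le> card D * M"
proof -
  have "C \<subseteq> (\<Union>d\<in>D. {c \<in> C. h c = d})" using assms(3) by auto
  then have "card C \<le> card (\<Union>d\<in>D. {c \<in> C. h c = d})"
    using assms(1,2) by (intro card_mono) auto
  also have "\<dots> \<le> (\<Sum>d\<in>D. card {c \<in> C. h c = d})"
    by (rule card_UN_le) (rule assms(2))
  also have "\<dots> \<le> (\<Sum>d\<in>D. M)" by (rule sum_mono) (use assms(4) in auto)
  finally show ?thesis by simp
qed

lemma card_small_subsets_le:
  "card {S. S \<subseteq> {1..n} \<and> card S \<le> K} \<le> (n + 1) ^ K"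
proof -
  let ?L = "{xs. set xs \<subseteq> {0..n} \<and> length xs = K}"
  have "{S. S \<subseteq> {1..n} \<and> card S \<le> K} \<subseteq> (\<lambda>xs. set xs - {0}) ` ?L"
  proof
    fix S assume "S \<in> {S. S \<subseteq> {1..n} \<and> card S \<le> K}"
    then have S: "S \<subseteq> {1..n}" "card S \<le> K" by auto
    then have "finite S" using finite_subset by blast
    then obtain xs where "set xs = S" "distinct xs"
      using finite_distinct_list by blast
    then have xs: "set xs = S" "length xs = card S" using distinct_card[of xs] by auto
    \<comment> \<open>Padding with 0, which lies outside \<open>{1..n}\<close> and can be removed
      again, gives length exactly \<open>K\<close>; this dummy accounts for the base
      \<open>n + 1\<close>.\<close>
    let ?ys = "xs @ replicate (K - card S) 0"
    have "?ys \<in> ?L" "S = set ?ys - {0}" using xs S by auto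
    then show "S \<in> (\<lambda>xs. set xs - {0}) ` ?L" by blast
  qed
  then have "card {S. S \<subseteq> {1..n} \<and> card S \<le> K} \<le> card ((\<lambda>xs. set xs - {0}) ` ?L)"
    by (intro card_mono finite_imageI finite_lists_length_eq) auto
  also have "\<dots> \<le> card ?L"
    by (intro card_image_le finite_lists_length_eq) auto
  also have "\<dots> = (n + 1) ^ K" by (subst card_lists_length_eq) auto
  finally show ?thesis .
qed

lemma finite_small_subsets: "finite {S. S \<subseteq> {1..n::nat} \<and> card S \<le> K}"
  by (rule finite_subset[of _ "Pow {1..n}"]) auto

section \<open>Hitting sets\<close>

text \<open>Double counting: the sets \<open>N b\<close> have at least \<open>p * card B\<close>
  incidences with at most \<open>q * p\<close> points, so some point lies in at least a fraction
  \<open>1 / q\<close> of them. The alternative \<open>B = {}\<close> covers an empty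
  \<open>X\<close>.\<close>

lemma ex_point_hitting_many:
  assumes "finite X" "finite B"
    and "\<And>b. b \<in> B \<Longrightarrow> N b \<subseteq> X \<and> p \<le> card (N b)"
    and "card X \<le> q * p" "p > 0"
  shows "\<exists>x. (x \<in> X \<or> B = {}) \<and> card B \<le> q * card {b \<in> B. x \<in> N b}"
proof (rule ccontr)
  assume neg: "\<not> ?thesis"
  then have B: "B \<noteq> {}" by force
  then obtain b0 where b0: "b0 \<in> B" by auto
  then have "N b0 \<noteq> {}" using assms(3)[OF b0] assms(5) by auto
  then have X: "X \<noteq> {}" using assms(3)[OF b0] by auto
  have lt: "q * card {b \<in> B. x \<in> N b} < card B" if "x \<in> X" for x
    using neg that by (meson not_le)
  have "(\<Sum>x\<in>X. q * card {b \<in> B. x \<in> N b}) < (\<Sum>x\<in>X. card B)"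
    by (rule sum_strict_mono) (use assms X lt in auto)
  also have "\<dots> \<le> q * p * card B" using assms(4) by simp
  finally have 1: "q * (\<Sum>x\<in>X. card {b \<in> B. x \<in> N b}) < q * (p * card B)"
    by (simp add: sum_distrib_left mult.assoc)
  have "(\<Sum>x\<in>X. card {b \<in> B. x \<in> N b}) = (\<Sum>b\<in>B. card {x \<in> X. x \<in> N b})"
    by (rule sum_multicount_gen) (use assms in auto)
  also have "\<dots> = (\<Sum>b\<in>B. card (N b))"
    by (intro sum.cong refl arg_cong[of _ _ card]) (use assms(3) in auto)
  also have "\<dots> \<ge> p * card B"
    using sum_mono[of B "\<lambda>_. p" "\<lambda>b. card (N b)"] assms(3) by (simp add: mult.commute)
  finally show False using 1 by (simp add: mult_less_cancel1)
qed

lemma greedy_hitting: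
  assumes "finite X" "finite B"
    and "\<And>b. b \<in> B \<Longrightarrow> N b \<subseteq> X \<and> p \<le> card (N b)"
    and "card X \<le> q * p" "p > 0" "q > 0"
  shows "\<exists>R\<subseteq>X. card R \<le> k \<and>
    real (card {b \<in> B. N b \<inter> R = {}}) \<le> real (card B) * (1 - 1 / real q) ^ k"
proof (induction k)
  case 0
  show ?case using assms(2) by (intro exI[of _ "{}"]) simp
next
  case (Suc k)
  then obtain R where R: "R \<subseteq> X" "card R \<le> k"
    and le: "real (card {b \<in> B. N b \<inter> R = {}}) \<le> real (card B) * (1 - 1 / real q) ^ k" by auto
  define B' where "B' = {b \<in> B. N b \<inter> R = {}}"
  have B': "finite B'" "B' \<subseteq> B" unfolding B'_def using assms(2) by auto
  obtain x where x: "x \<in> X \<or> B' = {}" "card B' \<le> q * card {b \<in> B'. x \<in> N b}"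
    using ex_point_hitting_many[OF assms(1) B'(1), of N p q] assms B'(2) by blast
  show ?case
  proof (cases "B' = {}")
    case True
    then have "card {b \<in> B. N b \<inter> R = {}} = 0" unfolding B'_def by (metis card.empty)
    moreover have "0 \<le> real (card B) * (1 - 1 / real q) ^ Suc k"
      using assms(6) by (intro mult_nonneg_nonneg zero_le_power) auto
    ultimately show ?thesis using R by (intro exI[of _ R]) simp
  next
    case False
    let ?H = "{b \<in> B'. x \<in> N b}"
    have eq: "{b \<in> B. N b \<inter> insert x R = {}} = B' - ?H" by (auto simp: B'_def)
    have "card (B' - ?H) = card B' - card ?H" "card ?H \<le> card B'"
      using B' by (auto intro: card_Diff_subset card_mono)
    then have "real (card (B' - ?H)) = real (card B') - real (card ?H)" by simp
    also have "\<dots> \<le> real (card B') - real (card B') / real q"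
    proof -
      have "real (card B') \<le> real q * real (card ?H)"
        using x(2) by (simp flip: of_nat_mult)
      then show ?thesis using assms(6) by (simp add: field_simps)
    qed
    also have "\<dots> = real (card B') * (1 - 1 / real q)" by (simp add: algebra_simps)
    also have "\<dots> \<le> real (card B) * (1 - 1 / real q) ^ k * (1 - 1 / real q)"
      by (rule mult_right_mono) (use le assms(6) in \<open>auto simp: B'_def\<close>)
    finally have "real (card (B' - ?H)) \<le> real (card B) * (1 - 1 / real q) ^ Suc k"
      by (simp add: algebra_simps)
    moreover have "card (insert x R) \<le> Suc k"
      using R(2) card_insert_le_m1[of "Suc k" R x] by simp
    ultimately show ?thesis
      using x(1) False R(1) eq by (intro exI[of _ "insert x R"]) auto
  qed
qed

text \<open>After \<open>q * L\<close> greedy rounds at most \<open>card B * exp (- L)\<close> sets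
  are missed. This is below 1, so none is.\<close>

lemma hitting_set:
  assumes "finite X" "finite B"
    and "\<And>b. b \<in> B \<Longrightarrow> N b \<subseteq> X \<and> p \<le> card (N b)"
    and "card X \<le> q * p" "p > 0" "q > 0" "real (card B) < exp (real L)"
  shows "\<exists>R\<subseteq>X. card R \<le> q * L \<and> (\<forall>b\<in>B. N b \<inter> R \<noteq> {})"
proof -
  obtain R where R: "R \<subseteq> X" "card R \<le> q * L"
    and le: "real (card {b \<in> B. N b \<inter> R = {}}) \<le> real (card B) * (1 - 1 / real q) ^ (q * L)"
    using greedy_hitting[where N = N and k = "q * L", OF assms(1-6)] by auto
  have "(1 - 1 / real q) ^ (q * L) \<le> exp (- (1 / real q)) ^ (q * L)"
    using exp_ge_add_one_self[of "- (1 / real q)"] assms(6) by (intro power_mono) auto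
  also have "\<dots> = exp (- real L)"
    using assms(6) by (simp add: exp_of_nat_mult[symmetric])
  finally have "real (card {b \<in> B. N b \<inter> R = {}}) \<le> real (card B) * exp (- real L)"
    using le by (meson mult_left_mono of_nat_0_le_iff order_trans)
  also have "\<dots> < 1" using assms(7) by (simp add: exp_minus field_simps)
  finally have "{b \<in> B. N b \<inter> R = {}} = {}" using assms(2) by simp
  then show ?thesis using R by blast
qed

text \<open>Each of \<open>t\<close> rounds hits what is left of every set once the points chosen so
  far are deleted. The surplus \<open>t * (q * L)\<close> in the size of \<open>N b\<close> pays for
  the deletions.\<close>

lemma multiple_hitting_set:
  assumes "finite X" "finite B"
    and "card X \<le> q * p" "p > 0" "q > 0" "real (card B) < exp (real L)"
    and "\<And>b. b \<in> B \<Longrightarrow> N b \<subseteq> X \<and> p + t * (q * L) \<le> card (N b)"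
  shows "\<exists>R\<subseteq>X. card R \<le> t * (q * L) \<and> (\<forall>b\<in>B. t \<le> card (N b \<inter> R))"
  using assms(7)
proof (induction t)
  case 0
  show ?case by (intro exI[of _ "{}"]) simp
next
  case (Suc t)
  then have "\<And>b. b \<in> B \<Longrightarrow> N b \<subseteq> X \<and> p + t * (q * L) \<le> card (N b)" by force
  from Suc.IH[OF this] obtain R where R: "R \<subseteq> X" "card R \<le> t * (q * L)"
    and hit: "\<And>b. b \<in> B \<Longrightarrow> t \<le> card (N b \<inter> R)" by blast
  have finR: "finite R" using R(1) assms(1) finite_subset by blast
  have "N b - R \<subseteq> X \<and> p \<le> card (N b - R)" if "b \<in> B" for b
    using Suc.prems[OF that] R(2) diff_card_le_card_Diff[OF finR, of "N b"] by auto
  from hitting_set[where N = "\<lambda>b. N b - R", OF assms(1,2) this assms(3-6)] obtain R'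
    where R': "R' \<subseteq> X" "card R' \<le> q * L" "\<And>b. b \<in> B \<Longrightarrow> (N b - R) \<inter> R' \<noteq> {}" by blast
  have "card (R \<union> R') \<le> Suc t * (q * L)"
    using card_Un_le[of R R'] R(2) R'(2) by simp
  moreover have "Suc t \<le> card (N b \<inter> (R \<union> R'))" if b: "b \<in> B" for b
  proof -
    obtain x where x: "x \<in> N b" "x \<notin> R" "x \<in> R'" using R'(3)[OF b] by blast
    have fin: "finite (N b \<inter> R)" "finite (N b \<inter> (R \<union> R'))"
      using Suc.prems[OF b] assms(1) finite_subset by blast+
    have "Suc t \<le> card (insert x (N b \<inter> R))" using hit[OF b] x fin by simp
    also have "\<dots> \<le> card (N b \<inter> (R \<union> R'))" using x fin by (intro card_mono) auto
    finally show ?thesis .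
  qed
  ultimately show ?case using R(1) R'(1) by (intro exI[of _ "R \<union> R'"]) auto
qed

section \<open>Absolute differences\<close>

text \<open>Natural subtraction truncates at 0, so at least one of the two summands
  vanishes.\<close>

definition adiff :: "nat \<Rightarrow> nat \<Rightarrow> nat" where
  "adiff x y = (x - y) + (y - x)"

lemma adiff_commute: "adiff x y = adiff y x"
  by (simp add: adiff_def)

lemma card_adiff_fibre_le: "card {x \<in> P. adiff x u = z} \<le> 2"
proof -
  have "{x \<in> P. adiff x u = z} \<subseteq> {u + z, u - z}" by (auto simp: adiff_def)
  then have "card {x \<in> P. adiff x u = z} \<le> card {u + z, u - z}" by (intro card_mono) auto
  also have "\<dots> \<le> 2" by (simp add: card_insert_if)
  finally show ?thesis .
qed

lemma card_le_2_card_adiff_image: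
  assumes "finite P"
  shows "card P \<le> 2 * card ((\<lambda>x. adiff x u) ` P)"
  using card_le_card_times_fibre[of P "(\<lambda>x. adiff x u) ` P" "\<lambda>x. adiff x u" 2]
    assms card_adiff_fibre_le by (simp add: mult.commute)

lemma card_adiff_vimage_le:
  assumes "finite P" "finite Q"
  shows "card {x \<in> P. adiff x u \<in> Q} \<le> 2 * card Q"
proof -
  have "card {x \<in> P. adiff x u \<in> Q} \<le> card Q * 2"
  proof (rule card_le_card_times_fibre[where h = "\<lambda>x. adiff x u"])
    show "card {c \<in> {x \<in> P. adiff x u \<in> Q}. adiff c u = d} \<le> 2" for d
      by (rule card_adiff_fibre_le)
  qed (use assms in auto)
  then show ?thesis by simp
qed

text \<open>Both members of a pair \<open>x\<close>, \<open>adiff x (v b)\<close> have to be caught.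
  \<open>U\<close> first meets every \<open>P b\<close> in \<open>2 * t\<close> points; taking
  differences is at most two-to-one, so these give \<open>t\<close> differences, and a second
  hitting set \<open>R\<close> catches one of them.\<close>

lemma pair_hitting_set:
  fixes P :: "'b \<Rightarrow> nat set" and v :: "'b \<Rightarrow> nat"
  assumes "finite A" "A \<subseteq> {1..n}" "finite B" "real (card B) < exp (real L)"
    and "n \<le> q * p" "p > 0" "q > 0" "n \<le> q' * t" "t > 0" "q' > 0"
    and P: "\<And>b. b \<in> B \<Longrightarrow> P b \<subseteq> A \<and> p + 2 * t * (q * L) \<le> card (P b)"
    and PA: "\<And>b x. b \<in> B \<Longrightarrow> x \<in> P b \<Longrightarrow> adiff x (v b) \<in> A"
  shows "\<exists>U R. U \<subseteq> (\<Union>b\<in>B. P b) \<and> R \<subseteq> A \<and> card U \<le> 2 * t * (q * L) \<and> card R \<le> q' * L \<and>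
    (\<forall>b\<in>B. \<exists>x\<in>U \<inter> P b. adiff x (v b) \<in> R)"
proof -
  have cA: "card A \<le> n" using card_mono[OF _ assms(2)] by simp
  \<comment> \<open>Drawing \<open>U\<close> from this union instead of from \<open>A\<close> lets
    it inherit properties common to all \<open>P b\<close>, such as stability of the
    elements.\<close>
  let ?X = "\<Union>b\<in>B. P b"
  have X: "?X \<subseteq> A" using P by blast
  then have finX: "finite ?X" using assms(1) finite_subset by blast
  have cX: "card ?X \<le> q * p" using assms(5) cA card_mono[OF assms(1) X] by linarith
  have "P b \<subseteq> ?X \<and> p + 2 * t * (q * L) \<le> card (P b)" if "b \<in> B" for b
    using P that by blast
  from multiple_hitting_set[where N = P, OF finX assms(3) cX assms(6,7,4) this]
  obtain U where U: "U \<subseteq> ?X" "card U \<le> 2 * t * (q * L)" "\<And>b. b \<in> B \<Longrightarrow> 2 * t \<le> card (P b \<inter> U)"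
    by blast
  define N where "N b = (\<lambda>x. adiff x (v b)) ` (P b \<inter> U)" for b
  have "N b \<subseteq> A \<and> t \<le> card (N b)" if b: "b \<in> B" for b
  proof -
    have "finite (P b \<inter> U)" using P[OF b] assms(1) finite_subset by blast
    then have "card (P b \<inter> U) \<le> 2 * card (N b)"
      unfolding N_def by (rule card_le_2_card_adiff_image)
    then show ?thesis using U(3)[OF b] PA[OF b] by (auto simp: N_def)
  qed
  moreover have "card A \<le> q' * t" using cA assms(8) by linarith
  ultimately obtain R where R: "R \<subseteq> A" "card R \<le> q' * L" "\<And>b. b \<in> B \<Longrightarrow> N b \<inter> R \<noteq> {}"
    using hitting_set[OF assms(1,3), of N t q' L] assms(4,9,10) by blast
  have "\<exists>x\<in>U \<inter> P b. adiff x (v b) \<in> R" if "b \<in> B" for b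
    using R(3)[OF that] by (auto simp: N_def)
  then show ?thesis using U R by blast
qed

text \<open>The larger of \<open>u\<close> and \<open>y\<close> is the sum of the smaller one and
  the difference. If \<open>u\<close> had a third colour, all three colours and hence all three
  elements would differ, and this sum would be rainbow.\<close>

lemma rainbow_sum_free_adiff:
  assumes "rainbow_sum_free A f" "u \<in> A" "y \<in> A" "adiff y u \<in> A" "f y \<noteq> f (adiff y u)"
  shows "f u = f y \<or> f u = f (adiff y u)"
proof (rule ccontr)
  assume neg: "\<not> ?thesis"
  let ?z = "adiff y u"
  have d: "u \<noteq> y" "y \<noteq> ?z" "u \<noteq> ?z" using neg assms(5) by metis+
  have "rainbow_sum A f u ?z y \<or> rainbow_sum A f y ?z u"
    using neg assms d unfolding rainbow_sum_def by (cases "u \<le> y") (auto simp: adiff_def)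
  then show False using assms(1) unfolding rainbow_sum_free_def by blast
qed

section \<open>Families of functions determined by few values\<close>

lemma card_family_le_power:
  assumes "finite V" "finite Z"
    and "\<And>f. f \<in> \<F> \<Longrightarrow> f ` Z \<subseteq> V"
    and "\<And>f h. f \<in> \<F> \<Longrightarrow> h \<in> \<F> \<Longrightarrow> (\<And>x. x \<in> Z \<Longrightarrow> f x = h x) \<Longrightarrow> f = h"
  shows "card \<F> \<le> card V ^ card Z"
proof -
  have "inj_on (\<lambda>f. restrict f Z) \<F>"
  proof (rule inj_onI)
    fix f h assume fh: "f \<in> \<F>" "h \<in> \<F>" and eq: "restrict f Z = restrict h Z"
    have "f x = h x" if "x \<in> Z" for x using fun_cong[OF eq, of x] that by simp
    then show "f = h" using assms(4) fh by blast
  qed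
  moreover have "(\<lambda>f. restrict f Z) ` \<F> \<subseteq> Z \<rightarrow>\<^sub>E V" using assms(3) by fastforce
  moreover have "finite (Z \<rightarrow>\<^sub>E V)" using assms(1,2) by (simp add: finite_PiE)
  ultimately have "card \<F> \<le> card (Z \<rightarrow>\<^sub>E V)" by (rule card_inj_on_le)
  then show ?thesis using assms(2) by (simp add: card_PiE)
qed

lemma colorings_eqI:
  assumes "f \<in> colorings A r" "h \<in> colorings A r" "\<And>x. x \<in> A \<Longrightarrow> f x = h x"
  shows "f = h"
  using assms unfolding colorings_def by (auto intro: PiE_ext)

lemma finite_colorings: "finite A \<Longrightarrow> finite (colorings A r)"
  unfolding colorings_def by (simp add: finite_PiE)

text \<open>This is the source of the main term: each of the \<open>r choose 2\<close> pairs of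
  colours contributes at most \<open>2 ^ card A\<close>.\<close>

lemma card_colorings_two_colours:
  assumes "finite A" "card P = 2"
  shows "card {f \<in> colorings A r. f ` A \<subseteq> P} \<le> 2 ^ card A"
  using card_family_le_power[of P A "{f \<in> colorings A r. f ` A \<subseteq> P}"] assms
  by (force intro: colorings_eqI card_ge_0_finite)

section \<open>Colour classes and almost invariant shifts\<close>

definition colour_class :: "nat set \<Rightarrow> (nat \<Rightarrow> nat) \<Rightarrow> nat \<Rightarrow> nat set" where
  "colour_class A f d = {y \<in> A. f y = d}"

definition splits :: "nat set \<Rightarrow> nat set \<Rightarrow> nat \<Rightarrow> nat set" where
  "splits A F u = {y \<in> A. adiff y u \<in> A \<and> (y \<in> F) \<noteq> (adiff y u \<in> F)}"

definition stable :: "nat \<Rightarrow> nat set \<Rightarrow> nat set \<Rightarrow> nat set" where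
  "stable s A F = {u \<in> A. card (splits A F u) < s}"

section \<open>Colourings in which three colours have few stable elements\<close>

text \<open>For \<open>y\<close> outside the three stable sets, \<open>splits\<close> has at least
  \<open>s\<close> elements for each colour in \<open>D\<close>. One pair hitting set serves all
  such \<open>(y, d)\<close>, of which there are at most \<open>3 * n\<close>.\<close>

lemma ex_determining_set:
  assumes "finite A" "A \<subseteq> {1..n}" "real (3 * n) < exp (real L)"
    and "n \<le> q * p" "p > 0" "q > 0" "n \<le> q' * t" "t > 0" "q' > 0"
    and s: "s = p + 2 * t * (q * L)"
    and f: "rainbow_sum_free A f" and D: "card D = 3"
  shows "\<exists>S\<subseteq>A. card S \<le> 2 * t * (q * L) + q' * L \<and>
    (\<forall>h. rainbow_sum_free A h \<longrightarrow> (\<forall>x\<in>S. h x = f x) \<longrightarrow>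
      (\<forall>y\<in>A - (\<Union>d\<in>D. stable s A (colour_class A f d)). h y = f y))"
proof -
  define Z where "Z = (\<Union>d\<in>D. stable s A (colour_class A f d))"
  define B where "B = (A - Z) \<times> D"
  define P where "P b = splits A (colour_class A f (snd b)) (fst b)" for b :: "nat \<times> nat"
  have finD: "finite D" by (rule ccontr) (use D in simp)
  then have finB: "finite B" using assms(1) by (simp add: B_def)
  have "card B \<le> card (A \<times> D)"
    unfolding B_def using assms(1) finD by (intro card_mono) auto
  also have "\<dots> \<le> n * 3"
    using D card_mono[OF _ assms(2)] by (simp add: card_cartesian_product)
  finally have cB: "real (card B) < exp (real L)" using assms(3) by linarith
  have P: "P b \<subseteq> A \<and> p + 2 * t * (q * L) \<le> card (P b)" if "b \<in> B" for b
  proof -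
    have "fst b \<in> A - stable s A (colour_class A f (snd b))"
      using that by (auto simp: B_def Z_def)
    then show ?thesis using s by (auto simp: P_def stable_def splits_def)
  qed
  have PA: "adiff x (fst b) \<in> A" if "b \<in> B" "x \<in> P b" for b x
    using that by (simp add: P_def splits_def)
  obtain U R where UR: "U \<subseteq> (\<Union>b\<in>B. P b)" "R \<subseteq> A"
    "card U \<le> 2 * t * (q * L)" "card R \<le> q' * L"
    "\<And>b. b \<in> B \<Longrightarrow> \<exists>x\<in>U \<inter> P b. adiff x (fst b) \<in> R"
    using pair_hitting_set[where P = P and v = fst, OF assms(1,2) finB cB assms(4-9) P PA] by metis
  have "(\<Union>b\<in>B. P b) \<subseteq> A" by (auto simp: P_def splits_def)
  then have S: "U \<union> R \<subseteq> A" "card (U \<union> R) \<le> 2 * t * (q * L) + q' * L"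
    using UR card_Un_le[of U R] by auto
  moreover have "h y = f y" if h: "rainbow_sum_free A h" "\<forall>x\<in>U \<union> R. h x = f x" and y: "y \<in> A - Z" for h y
  proof (rule ccontr)
    assume ne: "h y \<noteq> f y"
    \<comment> \<open>Both \<open>f y\<close> and \<open>h y\<close> are among the two colours of
      the split pair. Being different, they exhaust these colours, one of which is \<open>d\<close>;
      but two values cannot account for three colours.\<close>
    have "d \<in> {f y, h y}" if d: "d \<in> D" for d
    proof -
      have "(y, d) \<in> B" using y d by (simp add: B_def)
      then obtain x where x: "x \<in> U" "x \<in> P (y, d)" "adiff x y \<in> R" using UR(5) by fastforce
      let ?z = "adiff x y"
      have xz: "x \<in> A" "?z \<in> A" "f x = d \<and> f ?z \<noteq> d \<or> f x \<noteq> d \<and> f ?z = d"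
        using x(2) by (auto simp: P_def splits_def colour_class_def)
      have hx: "h x = f x" "h ?z = f ?z" using h(2) x by auto
      have "f y = f x \<or> f y = f ?z" using rainbow_sum_free_adiff[OF f _ xz(1,2)] y xz(3) by auto
      moreover have "h y = f x \<or> h y = f ?z"
        using rainbow_sum_free_adiff[OF h(1) _ xz(1,2)] y xz(3) hx by auto
      ultimately show ?thesis using ne xz(3) by auto
    qed
    then have "card D \<le> card {f y, h y}" by (intro card_mono) auto
    then show False using D ne by simp
  qed
  ultimately show ?thesis unfolding Z_def[symmetric] by (intro exI[of _ "U \<union> R"]) auto
qed

text \<open>A colouring is encoded by a determining set \<open>S f\<close> and its restriction to
  it, with at most \<open>(n + 1) ^ K * r ^ K\<close> codes. Colourings with the same code differ
  only on a set of at most \<open>3 * T\<close> elements.\<close>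

lemma card_three_unstable_colours_le:
  assumes "finite A" "A \<subseteq> {1..n}" "real (3 * n) < exp (real L)"
    and "n \<le> q * p" "p > 0" "q > 0" "n \<le> q' * t" "t > 0" "q' > 0"
    and s: "s = p + 2 * t * (q * L)"
    and K: "2 * t * (q * L) + q' * L \<le> K" and r: "r \<ge> 1"
  shows "card {f \<in> colorings A r. rainbow_sum_free A f \<and> 3 \<le> card {d \<in> {1..r}. card (stable s A (colour_class A f d)) \<le> T}}
    \<le> ((n + 1) ^ K * r ^ K) * r ^ (3 * T)" (is "card ?C \<le> _")
proof -
  define ok where "ok f S Z \<longleftrightarrow> S \<subseteq> A \<and> card S \<le> K \<and> Z \<subseteq> A \<and> card Z \<le> 3 * T \<and>
    (\<forall>h. rainbow_sum_free A h \<longrightarrow> (\<forall>x\<in>S. h x = f x) \<longrightarrow> (\<forall>y\<in>A - Z. h y = f y))" for f S Z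
  have ex: "\<exists>S Z. ok f S Z" if "f \<in> ?C" for f
  proof -
    have f: "rainbow_sum_free A f"
      and "3 \<le> card {d \<in> {1..r}. card (stable s A (colour_class A f d)) \<le> T}"
      using that by simp_all
    then obtain D where D: "D \<subseteq> {d \<in> {1..r}. card (stable s A (colour_class A f d)) \<le> T}" "card D = 3"
      by (meson obtain_subset_with_card_n)
    let ?Z = "\<Union>d\<in>D. stable s A (colour_class A f d)"
    have "finite D" by (rule ccontr) (use D(2) in simp)
    then have "card ?Z \<le> (\<Sum>d\<in>D. card (stable s A (colour_class A f d)))"
      by (rule card_UN_le)
    also have "\<dots> \<le> (\<Sum>d\<in>D. T)" by (rule sum_mono) (use D(1) in auto)
    also have "\<dots> = 3 * T" using D(2) by simp
    finally have cZ: "card ?Z \<le> 3 * T" .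
    have ZA: "?Z \<subseteq> A" by (auto simp: stable_def)
    obtain S where S: "S \<subseteq> A" "card S \<le> 2 * t * (q * L) + q' * L"
      and det: "\<forall>h. rainbow_sum_free A h \<longrightarrow> (\<forall>x\<in>S. h x = f x) \<longrightarrow> (\<forall>y\<in>A - ?Z. h y = f y)"
      using ex_determining_set[OF assms(1-10) f D(2)] by (elim exE conjE)
    have "ok f S ?Z" unfolding ok_def by (intro conjI S(1) order_trans[OF S(2) K] ZA cZ det)
    then show ?thesis by blast
  qed
  define S where "S f = (SOME S. \<exists>Z. ok f S Z)" for f
  have S: "\<exists>Z. ok f (S f) Z" if "f \<in> ?C" for f
    unfolding S_def by (rule someI_ex) (rule ex[OF that])
  let ?Small = "{S. S \<subseteq> {1..n} \<and> card S \<le> K}"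
  let ?D = "Sigma ?Small (\<lambda>S. S \<rightarrow>\<^sub>E {1..r})"
  have finS: "finite X" if "X \<in> ?Small" for X using that finite_subset by auto
  have finE: "finite (X \<rightarrow>\<^sub>E {1..r})" if "X \<in> ?Small" for X
    by (rule finite_PiE[OF finS[OF that]]) simp
  have finD: "finite ?D" by (rule finite_SigmaI[OF finite_small_subsets finE])
  have "card ?D = (\<Sum>X\<in>?Small. card (X \<rightarrow>\<^sub>E {1..r}))"
    by (rule card_SigmaI[OF finite_small_subsets]) (intro ballI finE)
  also have "\<dots> \<le> (\<Sum>X\<in>?Small. r ^ K)"
  proof (rule sum_mono)
    fix X assume X: "X \<in> ?Small"
    then show "card (X \<rightarrow>\<^sub>E {1..r}) \<le> r ^ K"
      using finS[OF X] r by (simp add: card_PiE power_increasing)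
  qed
  also have "\<dots> \<le> (n + 1) ^ K * r ^ K" using card_small_subsets_le[of n K] by simp
  finally have cD: "card ?D \<le> (n + 1) ^ K * r ^ K" .
  have "card ?C \<le> card ?D * r ^ (3 * T)"
  proof (rule card_le_card_times_fibre)
    show "finite ?C" using finite_colorings[OF assms(1)] by simp
    show "finite ?D" by (rule finD)
    show "(\<lambda>f. (S f, restrict f (S f))) ` ?C \<subseteq> ?D"
    proof
      fix x assume "x \<in> (\<lambda>f. (S f, restrict f (S f))) ` ?C"
      then obtain f where f: "f \<in> ?C" and x: "x = (S f, restrict f (S f))" by blast
      have "S f \<subseteq> A" "card (S f) \<le> K" using S[OF f] unfolding ok_def by simp_all
      moreover have "restrict f (S f) \<in> S f \<rightarrow>\<^sub>E {1..r}"
        using f \<open>S f \<subseteq> A\<close> by (auto simp: colorings_def)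
      ultimately show "x \<in> ?D" using assms(2) x by auto
    qed
    fix d assume "d \<in> ?D"
    let ?F = "{f \<in> ?C. (S f, restrict f (S f)) = d}"
    show "card ?F \<le> r ^ (3 * T)"
    proof (cases "?F = {}")
      case False
      then obtain f0 where f0: "f0 \<in> ?F" by blast
      then have "f0 \<in> ?C" by blast
      \<comment> \<open>\<open>Z\<close> belongs to one fixed member \<open>f0\<close> of the fibre.
        All other members agree with \<open>f0\<close> off this same set, so \<open>Z\<close> does
        not enter the code.\<close>
      from S[OF this] obtain Z where "ok f0 (S f0) Z" ..
      note okZ = this[unfolded ok_def]
      have Z: "Z \<subseteq> A" using okZ by (elim conjE)
      have cZ: "card Z \<le> 3 * T" using okZ by (elim conjE)
      have det: "\<forall>h. rainbow_sum_free A h \<longrightarrow> (\<forall>x\<in>S f0. h x = f0 x) \<longrightarrow> (\<forall>y\<in>A - Z. h y = f0 y)"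
        using okZ by (elim conjE)
      have agree: "h y = f0 y" if h: "h \<in> ?F" and y: "y \<in> A - Z" for h y
      proof -
        have "rainbow_sum_free A h" using h by blast
        moreover have "\<forall>x\<in>S f0. h x = f0 x"
        proof
          fix x assume x: "x \<in> S f0"
          have "S h = S f0" "restrict h (S h) = restrict f0 (S f0)" using h f0 by auto
          then have "restrict h (S f0) x = restrict f0 (S f0) x" by simp
          then show "h x = f0 x" using x by simp
        qed
        ultimately show ?thesis using det y by blast
      qed
      have "card ?F \<le> card {1..r} ^ card Z"
      proof (rule card_family_le_power)
        show "finite Z" using Z assms(1) finite_subset by blast
        show "f ` Z \<subseteq> {1..r}" if "f \<in> ?F" for f
          using that Z by (auto simp: colorings_def)
        fix h h' assume h: "h \<in> ?F" "h' \<in> ?F" and eq: "\<And>x. x \<in> Z \<Longrightarrow> h x = h' x"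
        show "h = h'"
        proof (rule colorings_eqI)
          show "h \<in> colorings A r" "h' \<in> colorings A r" using h by auto
          show "h x = h' x" if "x \<in> A" for x
            using eq agree[OF h(1)] agree[OF h(2)] that by (cases "x \<in> Z") auto
        qed
      qed simp
      also have "\<dots> \<le> r ^ (3 * T)" using cZ r by (simp add: power_increasing)
      finally show ?thesis .
    next
      case True
      show ?thesis unfolding True by simp
    qed
  qed
  also have "\<dots> \<le> ((n + 1) ^ K * r ^ K) * r ^ (3 * T)" using cD by (rule mult_right_mono) simp
  finally show ?thesis .
qed

section \<open>Colour classes with many stable elements\<close>

text \<open>
  Any two members of \<open>traceable K A\<close> with the same witnesses \<open>U\<close> and \<open>S\<close> and the same trace on \<open>S\<close>
  are equal.
\<close>

definition traceable :: "nat \<Rightarrow> nat set \<Rightarrow> nat set set" where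
  "traceable K A = {F. F \<subseteq> A \<and> (\<exists>U S. U \<subseteq> A \<and> S \<subseteq> A \<and> card U \<le> K \<and> card S \<le> K \<and>
     (\<forall>y\<in>A - S. (\<exists>u\<in>U. adiff y u \<in> S) \<and> (\<forall>u\<in>U. adiff y u \<in> S \<longrightarrow> (y \<in> F \<longleftrightarrow> adiff y u \<in> F))))}"

lemma card_traceable_le:
  assumes "A \<subseteq> {1..n}"
  shows "finite (traceable K A)" and "card (traceable K A) \<le> ((n + 1) ^ K) ^ 3"
proof -
  have finA: "finite A" using assms finite_subset by blast
  show "finite (traceable K A)"
    by (rule finite_subset[of _ "Pow A"]) (use finA in \<open>auto simp: traceable_def\<close>)
  let ?Small = "{S. S \<subseteq> {1..n} \<and> card S \<le> K}"
  define ok where "ok F U S \<longleftrightarrow> U \<subseteq> A \<and> S \<subseteq> A \<and> card U \<le> K \<and> card S \<le> K \<and>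
     (\<forall>y\<in>A - S. (\<exists>u\<in>U. adiff y u \<in> S) \<and> (\<forall>u\<in>U. adiff y u \<in> S \<longrightarrow> (y \<in> F \<longleftrightarrow> adiff y u \<in> F)))"
    for F U S
  have tr: "traceable K A = {F. F \<subseteq> A \<and> (\<exists>U S. ok F U S)}"
    unfolding traceable_def ok_def by (rule refl)
  define U where "U F = (SOME U. \<exists>S. ok F U S)" for F
  define S where "S F = (SOME S. ok F (U F) S)" for F
  have ok: "ok F (U F) (S F)" if "F \<in> traceable K A" for F
  proof -
    have "\<exists>U S. ok F U S" using that unfolding tr by blast
    then have "\<exists>S. ok F (U F) S" unfolding U_def by (rule someI_ex)
    then show ?thesis unfolding S_def by (rule someI_ex)
  qed
  have sub: "U F \<subseteq> A" "S F \<subseteq> A" "card (U F) \<le> K" "card (S F) \<le> K" if "F \<in> traceable K A" for F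
    using ok[OF that] unfolding ok_def by simp_all
  have hit: "\<exists>u\<in>U F. adiff y u \<in> S F" if "F \<in> traceable K A" "y \<in> A" "y \<notin> S F" for F y
    using ok[OF that(1)] that(2,3) unfolding ok_def by simp
  have inv: "y \<in> F \<longleftrightarrow> adiff y u \<in> F"
    if "F \<in> traceable K A" "y \<in> A" "y \<notin> S F" "u \<in> U F" "adiff y u \<in> S F" for F y u
    using ok[OF that(1)] that(2-5) unfolding ok_def by simp
  \<comment> \<open>Witnesses and trace are three sets of size at most \<open>K\<close>, hence the
    third power. Membership off \<open>S F\<close> is recovered through a shift from
    \<open>U F\<close> that lands in \<open>S F\<close>.\<close>
  let ?h = "\<lambda>F. (U F, S F, F \<inter> S F)"
  have "inj_on ?h (traceable K A)"
  proof (rule inj_onI)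
    fix F G assume F: "F \<in> traceable K A" and G: "G \<in> traceable K A" and "?h F = ?h G"
    then have eq: "U G = U F" "S G = S F" "F \<inter> S F = G \<inter> S F" by auto
    have "y \<in> F \<longleftrightarrow> y \<in> G" if y: "y \<in> A" for y
    proof (cases "y \<in> S F")
      case False
      then obtain u where u: "u \<in> U F" "adiff y u \<in> S F" using hit[OF F y] by blast
      have "y \<in> F \<longleftrightarrow> adiff y u \<in> F" using inv[OF F y] False u by simp
      moreover have "y \<in> G \<longleftrightarrow> adiff y u \<in> G" using inv[OF G y] False u eq(1,2) by simp
      moreover have "adiff y u \<in> F \<longleftrightarrow> adiff y u \<in> G" using eq(3) u(2) by blast
      ultimately show ?thesis by simp
    qed (use eq(3) in blast)
    moreover have "F \<subseteq> A" "G \<subseteq> A" using F G unfolding tr by simp_all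
    ultimately show "F = G" by blast
  qed
  moreover have "?h ` traceable K A \<subseteq> ?Small \<times> ?Small \<times> ?Small"
  proof -
    have "?h F \<in> ?Small \<times> ?Small \<times> ?Small" if F: "F \<in> traceable K A" for F
    proof -
      have "finite (S F)" using sub(2)[OF F] finA finite_subset by blast
      then have "card (F \<inter> S F) \<le> card (S F)" by (intro card_mono) auto
      moreover have "U F \<subseteq> {1..n}" "S F \<subseteq> {1..n}" using sub(1,2)[OF F] assms by blast+
      ultimately show ?thesis using sub(3,4)[OF F] by auto
    qed
    then show ?thesis by blast
  qed
  ultimately have "card (traceable K A) \<le> card (?Small \<times> ?Small \<times> ?Small)"
    by (rule card_inj_on_le) (intro finite_cartesian_product finite_small_subsets)
  also have "\<dots> = card ?Small ^ 3" by (simp add: card_cartesian_product power3_eq_cube)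
  also have "\<dots> \<le> ((n + 1) ^ K) ^ 3" by (intro power_mono card_small_subsets_le) simp
  finally show "card (traceable K A) \<le> ((n + 1) ^ K) ^ 3" .
qed

text \<open>Pair hitting yields a small set \<open>U\<close> of stable elements such that every
  \<open>y\<close> has some \<open>u\<close> in \<open>U\<close> with \<open>adiff u y\<close> in
  \<open>R\<close>. Adding to \<open>R\<close> all exceptions of elements of \<open>U\<close>, fewer
  than \<open>s\<close> for each, makes membership in \<open>F\<close> invariant for the remaining
  \<open>y\<close>.\<close>

lemma traceable_if_many_stable:
  assumes "finite A" "A \<subseteq> {1..n}" "real (3 * n) < exp (real L)"
    and "n \<le> q * p" "p > 0" "q > 0" "n \<le> q' * t" "t > 0" "q' > 0"
    and F: "F \<subseteq> A" and Y: "p + 2 * t * (q * L) + 2 * (n - card A) < card (stable s A F)"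
    and K: "2 * t * (q * L) \<le> K" "q' * L + 2 * t * (q * L) * s \<le> K"
  shows "F \<in> traceable K A"
proof -
  let ?Y = "stable s A F"
  define P where "P y = {u \<in> ?Y. adiff u y \<in> A}" for y
  have finY: "finite ?Y" "?Y \<subseteq> A" using assms(1) by (auto simp: stable_def)
  have cA: "card A \<le> n" using card_mono[OF _ assms(2)] by simp
  have cB: "real (card A) < exp (real L)" using assms(3) cA by linarith
  have P: "P y \<subseteq> A \<and> p + 2 * t * (q * L) \<le> card (P y)" if y: "y \<in> A" for y
  proof -
    have yn: "1 \<le> y" "y \<le> n" using assms(2) y by auto
    let ?V = "{u \<in> ?Y. adiff u y \<in> {1..n} - A}"
    \<comment> \<open>A stable \<open>u\<close> is lost only if \<open>u = y\<close> or if the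
      difference is one of the \<open>n - card A\<close> missing numbers, each of which arises from
      at most two \<open>u\<close>. The strict inequality in the hypothesis on
      \<open>card (stable s A F)\<close> absorbs the loss of \<open>u = y\<close>.\<close>
    have "?Y \<subseteq> P y \<union> (?V \<union> {y})"
    proof
      fix u assume u: "u \<in> ?Y"
      then have un: "1 \<le> u" "u \<le> n" using finY(2) assms(2) by auto
      have "adiff u y \<in> {1..n}" if "u \<noteq> y" using un yn that by (auto simp: adiff_def)
      then show "u \<in> P y \<union> (?V \<union> {y})" using u unfolding P_def by blast
    qed
    then have "card ?Y \<le> card (P y \<union> (?V \<union> {y}))"
      using finY(1) by (intro card_mono) (auto simp: P_def)
    also have "\<dots> \<le> card (P y) + (card ?V + 1)"
      using card_Un_le[of "P y" "?V \<union> {y}"] card_Un_le[of ?V "{y}"] by simp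
    also have "card ?V \<le> 2 * card ({1..n} - A)"
      by (rule card_adiff_vimage_le) (use finY(1) in auto)
    also have "card ({1..n} - A) = n - card A" using assms(1,2) by (simp add: card_Diff_subset)
    finally show ?thesis using Y finY(2) by (auto simp: P_def)
  qed
  have PA: "adiff x (id y) \<in> A" if "y \<in> A" "x \<in> P y" for y x using that by (simp add: P_def)
  obtain U R where UR: "U \<subseteq> (\<Union>y\<in>A. P y)" "R \<subseteq> A"
    "card U \<le> 2 * t * (q * L)" "card R \<le> q' * L"
    "\<And>y. y \<in> A \<Longrightarrow> \<exists>u\<in>U \<inter> P y. adiff u (id y) \<in> R"
    using pair_hitting_set[where P = P and v = id, OF assms(1,2,1) cB assms(4-9) P PA] by metis
  have UY: "U \<subseteq> ?Y" using UR(1) by (auto simp: P_def)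
  have finU: "finite U" using UY finY finite_subset by blast
  let ?X = "\<Union>u\<in>U. splits A F u"
  have "card ?X \<le> (\<Sum>u\<in>U. card (splits A F u))" by (rule card_UN_le[OF finU])
  also have "\<dots> \<le> (\<Sum>u\<in>U. s)" by (rule sum_mono) (use UY in \<open>auto simp: stable_def\<close>)
  also have "\<dots> \<le> 2 * t * (q * L) * s" using UR(3) by simp
  finally have cS: "card (R \<union> ?X) \<le> K" using K(2) UR(4) card_Un_le[of R ?X] by linarith
  have SA: "R \<union> ?X \<subseteq> A" using UR(2) by (auto simp: splits_def)
  have U: "U \<subseteq> A" "card U \<le> K" using UY finY(2) UR(3) K(1) by auto
  have hit: "\<exists>u\<in>U. adiff y u \<in> R \<union> ?X" if "y \<in> A - (R \<union> ?X)" for y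
  proof -
    obtain u where "u \<in> U" "adiff u y \<in> R" using UR(5)[of y] \<open>y \<in> A - (R \<union> ?X)\<close> by auto
    then show ?thesis unfolding adiff_commute[of y] by blast
  qed
  have inv: "y \<in> F \<longleftrightarrow> adiff y u \<in> F"
    if "y \<in> A - (R \<union> ?X)" "u \<in> U" "adiff y u \<in> R \<union> ?X" for y u
  proof -
    have "adiff y u \<in> A" using that(3) SA by blast
    moreover have "y \<notin> splits A F u" "y \<in> A" using that(1,2) by auto
    ultimately show ?thesis by (simp add: splits_def)
  qed
  show ?thesis unfolding traceable_def mem_Collect_eq
    by (intro conjI exI[of _ U] exI[of _ "R \<union> ?X"] ballI impI F U SA cS hit inv)
qed

section \<open>Two-colourings with a prescribed element of a third colour\<close>

text \<open>The reference colouring \<open>c\<close> fixes where colours outside \<open>P\<close>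
  occur and what they are. As \<open>f x\<close> is not in \<open>P\<close>, on the other elements
  \<open>f\<close> must be invariant under \<open>adiff\<close> with \<open>x\<close>, which
  propagates its values from few starting points.\<close>

lemma card_two_colour_extensions_le:
  assumes "A \<subseteq> {1..n}" "card P = 2" "x \<in> A" "c x \<notin> P"
    and \<F>: "\<And>f. f \<in> \<F> \<Longrightarrow> f \<in> colorings A r \<and> rainbow_sum_free A f"
    and W: "\<And>f y. f \<in> \<F> \<Longrightarrow> y \<in> A \<Longrightarrow> c y \<notin> P \<Longrightarrow> f y = c y"
    and V: "\<And>f y. f \<in> \<F> \<Longrightarrow> y \<in> A \<Longrightarrow> c y \<in> P \<Longrightarrow> f y \<in> P"
  shows "card \<F> \<le> 2 ^ (5 * n div 6)"
proof -
  have finA: "finite A" using assms(1) finite_subset by blast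
  have finP: "finite P" by (rule ccontr) (use assms(2) in simp)
  define V where "V = {y \<in> A. c y \<in> P}"
  \<comment> \<open>These are the starting points: off \<open>Z\<close>, \<open>adiff y x\<close> is
    smaller than \<open>y\<close> and still in \<open>V\<close>, so the value at \<open>y\<close> is
    copied from a smaller element.\<close>
  define Z where "Z = {y \<in> V. 2 * y \<le> x \<or> adiff y x \<notin> V}"
  have finV: "finite V" and finZ: "finite Z" using finA by (auto simp: V_def Z_def)
  have V_sub: "V \<subseteq> A" and ZV: "Z \<subseteq> V" by (auto simp: V_def Z_def)
  have cV: "card V \<le> n" using V_sub assms(1) card_mono[of "{1..n}" V] by auto
  have extend: "f = h" if fh: "f \<in> \<F>" "h \<in> \<F>" and eq: "\<And>y. y \<in> V \<Longrightarrow> f y = h y" for f h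
  proof (rule colorings_eqI)
    show "f \<in> colorings A r" "h \<in> colorings A r" using \<F> fh by auto
    show "f y = h y" if "y \<in> A" for y
      using W[OF fh(1) that] W[OF fh(2) that] eq that by (cases "c y \<in> P") (auto simp: V_def)
  qed
  have le: "card \<F> \<le> 2 ^ card V"
    using card_family_le_power[of P V \<F>] finP finV V extend assms(2) by (force simp: V_def)
  have shift: "f y = f (adiff y x)" if f: "f \<in> \<F>" and y: "y \<in> V" "adiff y x \<in> V" for f y
  proof (rule ccontr)
    assume "f y \<noteq> f (adiff y x)"
    then have "f x = f y \<or> f x = f (adiff y x)"
      using rainbow_sum_free_adiff[of A f x y] \<F>[OF f] y assms(3) V_sub by blast
    moreover have "f y \<in> P" "f (adiff y x) \<in> P" using V[OF f] y by (auto simp: V_def)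
    moreover have "f x \<notin> P" using W[OF f] assms(3,4) by auto
    ultimately show False by auto
  qed
  have le': "card \<F> \<le> 2 ^ card Z"
  proof -
    have "card \<F> \<le> card P ^ card Z"
    proof (rule card_family_le_power)
      show "f ` Z \<subseteq> P" if "f \<in> \<F>" for f using V that by (auto simp: V_def Z_def)
      fix f h assume fh: "f \<in> \<F>" "h \<in> \<F>" and eq: "\<And>y. y \<in> Z \<Longrightarrow> f y = h y"
      have "y \<in> V \<longrightarrow> f y = h y" for y
      proof (induction y rule: less_induct)
        case (less y)
        show ?case
        proof
          assume y: "y \<in> V"
          show "f y = h y"
          proof (cases "y \<in> Z")
            case False
            then have z: "x < 2 * y" "adiff y x \<in> V" using y by (auto simp: Z_def)
            have "x > 0" using assms(1,3) by auto
            then have "adiff y x < y" using z(1) by (auto simp: adiff_def)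
            then show ?thesis using less z(2) shift[OF fh(1) y z(2)] shift[OF fh(2) y z(2)] by simp
          qed (rule eq)
        qed
      qed
      then show "f = h" using extend fh by blast
    qed (use finP finZ in auto)
    then show ?thesis using assms(2) by simp
  qed
  have "card Z \<le> n div 2 + 2 * (n - card V)"
  proof -
    let ?Q = "{y \<in> V. adiff y x \<in> {1..n} - V}"
    \<comment> \<open>Either \<open>2 * y \<le> x \<le> n\<close>, or the difference is a number in
      \<open>{1..n}\<close> outside \<open>V\<close>; it is not 0 because \<open>x\<close> lies
      outside \<open>V\<close>.\<close>
    have "Z \<subseteq> {1..n div 2} \<union> ?Q"
    proof
      fix y assume y: "y \<in> Z"
      have "y \<noteq> x" using y assms(4) by (auto simp: Z_def V_def)
      moreover have "y \<in> {1..n}" "x \<in> {1..n}" using y V_sub ZV assms(1,3) by blast+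
      ultimately show "y \<in> {1..n div 2} \<union> ?Q" using y by (auto simp: Z_def adiff_def)
    qed
    then have "card Z \<le> card ({1..n div 2} \<union> ?Q)" using finV by (intro card_mono) auto
    also have "\<dots> \<le> card {1..n div 2} + card ?Q" by (rule card_Un_le)
    also have "card ?Q \<le> 2 * card ({1..n} - V)"
      by (rule card_adiff_vimage_le) (use finV in auto)
    also have "card ({1..n} - V) = n - card V"
      using finV V_sub assms(1) by (subst card_Diff_subset) auto
    finally show ?thesis by simp
  qed
  \<comment> \<open>If \<open>card V > 5 n / 6\<close>, then \<open>n - card V < n / 6\<close> and so \<open>card Z \<le> n / 2 + n / 3\<close>.\<close>
  then have "card V \<le> 5 * n div 6 \<or> card Z \<le> 5 * n div 6" using cV by linarith
  then show ?thesis using le le' by (meson order_trans power_increasing one_le_numeral)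
qed

text \<open>The classes of the colours outside \<open>P\<close> form one of at most
  \<open>(((n + 1) ^ K) ^ 3) ^ r\<close> tuples. Such a tuple fixes all elements not coloured from
  \<open>P\<close>; at least one exists and serves as the shift \<open>x\<close> in
  \<open>card_two_colour_extensions_le\<close>.\<close>

lemma card_all_but_two_traceable_le:
  assumes "A \<subseteq> {1..n}" "card P = 2" "r \<ge> 1"
  shows "card {f \<in> colorings A r. rainbow_sum_free A f \<and> \<not> f ` A \<subseteq> P \<and>
      (\<forall>d\<in>{1..r} - P. colour_class A f d \<in> traceable K A)}
    \<le> (((n + 1) ^ K) ^ 3) ^ r * 2 ^ (5 * n div 6)" (is "card ?C \<le> _")
proof -
  have finA: "finite A" using assms(1) finite_subset by blast
  let ?D = "({1..r} - P) \<rightarrow>\<^sub>E traceable K A"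
  let ?h = "\<lambda>f. restrict (colour_class A f) ({1..r} - P)"
  have "card ?D = card (traceable K A) ^ card ({1..r} - P)" by (simp add: card_PiE)
  also have "\<dots> \<le> (((n + 1) ^ K) ^ 3) ^ card ({1..r} - P)"
    by (intro power_mono card_traceable_le assms) simp
  also have "\<dots> \<le> (((n + 1) ^ K) ^ 3) ^ r"
    using card_mono[of "{1..r}" "{1..r} - P"] by (intro power_increasing) auto
  finally have cD: "card ?D \<le> (((n + 1) ^ K) ^ 3) ^ r" .
  have "card ?C \<le> card ?D * 2 ^ (5 * n div 6)"
  proof (rule card_le_card_times_fibre)
    show "finite ?C" using finite_colorings[OF finA] by simp
    show "finite ?D" using card_traceable_le(1)[OF assms(1)] by (intro finite_PiE) auto
    show "?h ` ?C \<subseteq> ?D" by auto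
    fix d assume "d \<in> ?D"
    let ?F = "{f \<in> ?C. ?h f = d}"
    show "card ?F \<le> 2 ^ (5 * n div 6)"
    proof (cases "?F = {}")
      case False
      then obtain f0 where f0: "f0 \<in> ?F" by blast
      then obtain x where x: "x \<in> A" "f0 x \<notin> P" by auto
      have cls: "f y = c \<longleftrightarrow> f0 y = c" if "f \<in> ?F" "y \<in> A" "c \<in> {1..r} - P" for f y c
      proof -
        have "?h f = ?h f0" using that f0 by simp
        then have "colour_class A f c = colour_class A f0 c" using that(3) by (metis restrict_apply')
        then show ?thesis using that(2) by (auto simp: colour_class_def)
      qed
      have rng: "f y \<in> {1..r}" if "f \<in> ?F" "y \<in> A" for f y
        using that by (auto simp: colorings_def)
      show ?thesis
      proof (rule card_two_colour_extensions_le[where c = f0 and x = x, OF assms(1,2) x])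
        show "f \<in> colorings A r \<and> rainbow_sum_free A f" if "f \<in> ?F" for f using that by blast
        show "f y = f0 y" if "f \<in> ?F" "y \<in> A" "f0 y \<notin> P" for f y
          using cls[OF that(1,2)] rng[OF f0 that(2)] that(3) by blast
        show "f y \<in> P" if "f \<in> ?F" "y \<in> A" "f0 y \<in> P" for f y
        proof (rule ccontr)
          assume fP: "f y \<notin> P"
          then have "f y \<in> {1..r} - P" using rng[OF that(1,2)] by blast
          from cls[OF that(1,2) this] show False using fP that(3) by simp
        qed
      qed
    next
      case True
      show ?thesis unfolding True by simp
    qed
  qed
  also have "\<dots> \<le> (((n + 1) ^ K) ^ 3) ^ r * 2 ^ (5 * n div 6)" using cD by (rule mult_right_mono) simp
  finally show ?thesis .
qed

section \<open>The bound for fixed parameters\<close>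

text \<open>Either three colours have at most \<open>T\<close> stable elements, or all such colours
  fit into a pair \<open>P\<close>. In the second case \<open>A\<close> is coloured from
  \<open>P\<close> alone, or some element is not and all classes outside \<open>P\<close> are
  traceable.\<close>

lemma g_le:
  assumes A: "A \<subseteq> {1..n}" and r: "r \<ge> 3" and L: "real (3 * n) < exp (real L)"
    and m: "n \<le> m ^ 8" "m > 0" and p: "n \<le> 2 * r ^ 3 * p" "p > 0"
    and T: "p + 2 * m * (2 * r ^ 3 * L) + 2 * (n - card A) \<le> T"
    and s: "s = m ^ 5 + 2 * m * (m ^ 3 * L)"
    and K: "2 * m * (m ^ 3 * L) + m ^ 7 * L \<le> K" "2 * m * (2 * r ^ 3 * L) \<le> K"
      "m ^ 7 * L + 2 * m * (2 * r ^ 3 * L) * s \<le> K"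
  shows "g A r \<le> (r choose 2) * 2 ^ card A + (((n + 1) ^ K * r ^ K) * r ^ (3 * T)
    + (r choose 2) * ((((n + 1) ^ K) ^ 3) ^ r * 2 ^ (5 * n div 6)))"
proof -
  have finA: "finite A" using A finite_subset by blast
  let ?\<P> = "{P. P \<subseteq> {1..r} \<and> card P = 2}"
  let ?C1 = "{f \<in> colorings A r. rainbow_sum_free A f \<and> 3 \<le> card {d \<in> {1..r}. card (stable s A (colour_class A f d)) \<le> T}}"
  let ?C2 = "\<lambda>P. {f \<in> colorings A r. rainbow_sum_free A f \<and> \<not> f ` A \<subseteq> P \<and>
      (\<forall>d\<in>{1..r} - P. colour_class A f d \<in> traceable K A)}"
  let ?C0 = "\<lambda>P. {f \<in> colorings A r. f ` A \<subseteq> P}"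
  \<comment> \<open>These supply \<open>n \<le> q * p\<close> and \<open>n \<le> q' * t\<close>. For
    traceable classes \<open>q\<close> is instead the constant \<open>2 * r ^ 3\<close>, as linearly
    many elements are stable there.\<close>
  have m': "n \<le> m ^ 3 * m ^ 5" "n \<le> m ^ 7 * m" using m(1) by (simp_all flip: power_add power_Suc2)
  have fin\<P>: "finite ?\<P>" and card\<P>: "card ?\<P> = r choose 2"
    using n_subsets[of "{1..r}" 2] by auto
  have sub: "{f \<in> colorings A r. rainbow_sum_free A f} \<subseteq> (\<Union>P\<in>?\<P>. ?C0 P) \<union> (?C1 \<union> (\<Union>P\<in>?\<P>. ?C2 P))"
  proof
    fix f assume f: "f \<in> {f \<in> colorings A r. rainbow_sum_free A f}"
    define Q where "Q = {d \<in> {1..r}. card (stable s A (colour_class A f d)) \<le> T}"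
    show "f \<in> (\<Union>P\<in>?\<P>. ?C0 P) \<union> (?C1 \<union> (\<Union>P\<in>?\<P>. ?C2 P))"
    proof (cases "3 \<le> card Q")
      case True
      then have "f \<in> ?C1" using f unfolding Q_def by simp
      then show ?thesis by blast
    next
      case False
      have "Q \<subseteq> {1..r}" by (auto simp: Q_def)
      then obtain P where P: "Q \<subseteq> P" "P \<subseteq> {1..r}" "card P = 2"
        using exists_subset_between[of Q 2 "{1..r}"] False r by auto
      show ?thesis
      proof (cases "f ` A \<subseteq> P")
        case True
        then show ?thesis using f P by blast
      next
        case nP: False
        have "colour_class A f d \<in> traceable K A" if d: "d \<in> {1..r} - P" for d
        proof (rule traceable_if_many_stable[where s = s and t = m and q' = "m ^ 7" and q = "2 * r ^ 3"])
          have "d \<notin> Q" using d P(1) by blast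
          then have "T < card (stable s A (colour_class A f d))" using d by (auto simp: Q_def)
          then show "p + 2 * m * (2 * r ^ 3 * L) + 2 * (n - card A)
              < card (stable s A (colour_class A f d))" using T by linarith
        qed (use finA A L p r m m' K in \<open>auto simp: colour_class_def\<close>)
        then have "f \<in> ?C2 P" using f nP by blast
        then show ?thesis using P by blast
      qed
    qed
  qed
  have fin: "finite (colorings A r)" by (rule finite_colorings[OF finA])
  have "g A r \<le> card ((\<Union>P\<in>?\<P>. ?C0 P) \<union> (?C1 \<union> (\<Union>P\<in>?\<P>. ?C2 P)))"
    unfolding g_def by (rule card_mono[OF _ sub]) (use fin fin\<P> in auto)
  also have "\<dots> \<le> card (\<Union>P\<in>?\<P>. ?C0 P) + (card ?C1 + card (\<Union>P\<in>?\<P>. ?C2 P))"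
    by (meson card_Un_le add_left_mono order_trans)
  also have "\<dots> \<le> (\<Sum>P\<in>?\<P>. 2 ^ card A) + (((n + 1) ^ K * r ^ K) * r ^ (3 * T)
      + (\<Sum>P\<in>?\<P>. (((n + 1) ^ K) ^ 3) ^ r * 2 ^ (5 * n div 6)))"
  proof (intro add_mono)
    show "card (\<Union>P\<in>?\<P>. ?C0 P) \<le> (\<Sum>P\<in>?\<P>. 2 ^ card A)"
      by (rule order_trans[OF card_UN_le[OF fin\<P>] sum_mono])
        (use card_colorings_two_colours[OF finA] in auto)
    show "card (\<Union>P\<in>?\<P>. ?C2 P) \<le> (\<Sum>P\<in>?\<P>. (((n + 1) ^ K) ^ 3) ^ r * 2 ^ (5 * n div 6))"
      by (rule order_trans[OF card_UN_le[OF fin\<P>] sum_mono], rule card_all_but_two_traceable_le)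
        (use A r in auto)
    show "card ?C1 \<le> ((n + 1) ^ K * r ^ K) * r ^ (3 * T)"
      by (rule card_three_unstable_colours_le[where p = "m ^ 5" and q = "m ^ 3" and t = m and q' = "m ^ 7"])
        (use finA A L r m m' s K in auto)
  qed
  also have "\<dots> = (r choose 2) * 2 ^ card A + (((n + 1) ^ K * r ^ K) * r ^ (3 * T)
    + (r choose 2) * ((((n + 1) ^ K) ^ 3) ^ r * 2 ^ (5 * n div 6)))"
    using card\<P> by simp
  finally show ?thesis .
qed

section \<open>Asymptotics of the parameters\<close>

text \<open>Used to turn \<open>r ^ (3 * T)\<close> into a power of 2. The induction rests on
  \<open>Suc k ^ 3 \<le> 4 * k ^ 3\<close> for \<open>k \<ge> 3\<close>.\<close>

lemma cube_le_four_power: "3 \<le> r \<Longrightarrow> r ^ 3 \<le> (4::nat) ^ r"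
proof (induction r rule: dec_induct)
  case (step k)
  have "9 * k \<le> 3 * k ^ 2" using step(1) by (simp add: power2_eq_square)
  moreover have "3 * k ^ 2 \<le> k ^ 3" using step(1) by (simp add: power2_eq_square power3_eq_cube)
  moreover have "Suc k ^ 3 = k ^ 3 + 3 * k ^ 2 + 3 * k + 1"
    by (simp add: power2_eq_square power3_eq_cube algebra_simps)
  ultimately have "Suc k ^ 3 \<le> 4 * k ^ 3" using step(1) by linarith
  then show ?case using step.IH by simp
qed simp

text \<open>
  The sizes of all hitting sets are governed by \<open>m \<approx> n^(1/8)\<close> and \<open>L \<approx> ln (3 n)\<close>;
  stability allows about \<open>m^5\<close> exceptions. With these choices \<open>K log n\<close> has order \<open>n^(7/8) (log n)^3\<close>.
\<close>

definition admissible :: "nat \<Rightarrow> nat \<Rightarrow> nat \<Rightarrow> nat \<Rightarrow> nat \<Rightarrow> nat \<Rightarrow> bool" where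
  "admissible r n m L p K \<longleftrightarrow> real (3 * n) < exp (real L) \<and> n \<le> m ^ 8 \<and> m > 0 \<and>
    n \<le> 2 * r ^ 3 * p \<and> p > 0 \<and>
    real (p + 2 * m * (2 * r ^ 3 * L)) + 2 * (real n / real r ^ 3) \<le> 3 * (real n / real r ^ 3) - 1 \<and>
    K = 15 * r ^ 3 * m ^ 7 * L ^ 2 \<and> L > 0 \<and>
    real (5 * r * K) * ln (real (n + 1)) \<le> real n / 12 * ln 2"

lemma eventually_admissible:
  assumes r: "r \<ge> 3"
  shows "\<forall>\<^sub>F n in sequentially. \<exists>m L p K. admissible r n m L p K"
proof -
  have lim1: "(\<lambda>n::nat. (real n powr (1/8) + 1) * (ln (3 * real n) + 2) / real n) \<longlonglongrightarrow> 0"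
    by real_asymp
  have lim2: "(\<lambda>n::nat. (real n powr (1/8) + 1) ^ 7 * (ln (3 * real n) + 2) ^ 2 * ln (real n + 1) / real n) \<longlonglongrightarrow> 0"
    by real_asymp
  have R: "real r ^ 3 > 0" "real r > 0" using r by auto
  \<comment> \<open>The constant makes \<open>4 * r ^ 3 * m * L\<close> at most
    \<open>n / (4 * r ^ 3)\<close>, while \<open>p\<close> takes up
    \<open>n / (2 * r ^ 3) + 1\<close>. The remaining \<open>n / (4 * r ^ 3)\<close> exceeds 2 by
    \<open>ev3\<close>, which covers the rounding of \<open>p\<close> and the term
    \<open>- 1\<close>.\<close>
  have ev1: "\<forall>\<^sub>F n::nat in sequentially. (real n powr (1/8) + 1) * (ln (3 * real n) + 2) / real n < 1 / (16 * (real r ^ 3 * real r ^ 3))"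
    by (rule order_tendstoD(2)[OF lim1]) (use R in simp)
  \<comment> \<open>Here \<open>900 = 75 * 12\<close>, because
    \<open>5 * r * K = 75 * r ^ 4 * m ^ 7 * L ^ 2\<close> and the target is
    \<open>n / 12 * ln 2\<close>.\<close>
  have ev2: "\<forall>\<^sub>F n::nat in sequentially. (real n powr (1/8) + 1) ^ 7 * (ln (3 * real n) + 2) ^ 2 * ln (real n + 1) / real n < ln 2 / (900 * real r ^ 4)"
    by (rule order_tendstoD(2)[OF lim2]) (use R in simp)
  have ev3: "\<forall>\<^sub>F n::nat in sequentially. real n > 8 * real r ^ 3"
    by real_asymp
  show ?thesis
    using ev1 ev2 ev3 eventually_gt_at_top[of 0]
  proof eventually_elim
    case (elim n)
    define m where "m = nat \<lceil>real n powr (1/8)\<rceil>"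
    define L where "L = nat \<lceil>ln (3 * real n)\<rceil> + 1"
    define p where "p = nat \<lceil>real n / (2 * real r ^ 3)\<rceil>"
    define K where "K = 15 * r ^ 3 * m ^ 7 * L ^ 2"
    let ?x = "real n powr (1/8)" and ?l = "ln (3 * real n) + 2"
    have n: "real n \<ge> 1" using elim(4) by simp
    have x1: "?x \<ge> 1" using n by (simp add: ge_one_powr_ge_zero)
    have l1: "ln (3 * real n) \<ge> 0" using n by (intro ln_ge_zero) simp
    have m: "?x \<le> real m" "real m \<le> ?x + 1" unfolding m_def using x1 by linarith+
    have L: "ln (3 * real n) < real L" "real L \<le> ?l" unfolding L_def using l1 by linarith+
    have p: "real n / (2 * real r ^ 3) \<le> real p" "real p \<le> real n / (2 * real r ^ 3) + 1"
      unfolding p_def using R by (simp_all add: of_nat_ceiling)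
    have "exp (ln (3 * real n)) < exp (real L)" using L(1) by simp
    then have c1: "real (3 * n) < exp (real L)" using n by simp
    have "real n = ?x ^ 8" using n by (simp add: powr_realpow[symmetric] powr_powr)
    also have "\<dots> \<le> real m ^ 8" using m(1) x1 by (intro power_mono) auto
    finally have c2: "n \<le> m ^ 8" by (simp flip: of_nat_power)
    have c3: "m > 0" using m(1) x1 by (cases m) auto
    have "real n \<le> 2 * real r ^ 3 * real p" using p(1) R by (simp add: field_simps)
    then have "real n \<le> real (2 * r ^ 3 * p)" by simp
    then have c4: "n \<le> 2 * r ^ 3 * p" by (simp only: of_nat_le_iff)
    have c5: "p > 0" using c4 elim(4) by (cases p) auto
    have "real m * real L \<le> (?x + 1) * ?l" using m L x1 l1 by (intro mult_mono) auto
    also have "\<dots> < real n / (16 * (real r ^ 3 * real r ^ 3))" using elim(1) n R by (simp add: field_simps)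
    finally have "4 * real r ^ 3 * (real m * real L) \<le> 4 * real r ^ 3 * (real n / (16 * (real r ^ 3 * real r ^ 3)))"
      using R by (intro mult_left_mono) auto
    also have "\<dots> = (real n / real r ^ 3) / 4" using R by (simp add: field_simps)
    finally have "4 * real r ^ 3 * (real m * real L) \<le> (real n / real r ^ 3) / 4" .
    moreover have "real (p + 2 * m * (2 * r ^ 3 * L)) = real p + 4 * real r ^ 3 * (real m * real L)"
      by (simp add: algebra_simps)
    moreover have "real p \<le> (real n / real r ^ 3) / 2 + 1" using p(2) by simp
    moreover have "real n / real r ^ 3 > 8" using elim(3) R by (simp add: field_simps)
    ultimately have c6: "real (p + 2 * m * (2 * r ^ 3 * L)) + 2 * (real n / real r ^ 3) \<le> 3 * (real n / real r ^ 3) - 1"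
      by linarith
    have ln0: "ln (real n + 1) \<ge> 0" using n by simp
    have "real m ^ 7 * real L ^ 2 \<le> (?x + 1) ^ 7 * ?l ^ 2"
      using m L x1 l1 by (intro mult_mono power_mono) auto
    then have "real m ^ 7 * real L ^ 2 * ln (real n + 1) \<le> (?x + 1) ^ 7 * ?l ^ 2 * ln (real n + 1)"
      using ln0 by (rule mult_right_mono)
    also have "\<dots> \<le> real n * (ln 2 / (900 * real r ^ 4))" using elim(2) n R
      by (simp add: field_simps)
    finally have "75 * real r ^ 4 * (real m ^ 7 * real L ^ 2 * ln (real n + 1)) \<le> 75 * real r ^ 4 * (real n * (ln 2 / (900 * real r ^ 4)))"
      by (rule mult_left_mono) simp
    also have "\<dots> = real n / 12 * ln 2" using R by (simp add: field_simps)
    finally have "75 * real r ^ 4 * (real m ^ 7 * real L ^ 2 * ln (real n + 1)) \<le> real n / 12 * ln 2" .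
    moreover have "real (5 * r * K) * ln (real (n + 1))
        = 75 * real r ^ 4 * (real m ^ 7 * real L ^ 2 * ln (real n + 1))"
      by (simp add: K_def power3_eq_cube power4_eq_xxxx add.commute)
    ultimately have c7: "real (5 * r * K) * ln (real (n + 1)) \<le> real n / 12 * ln 2"
      by (simp only:)
    have "L > 0" by (simp add: L_def)
    then show ?case using c1 c2 c3 c4 c5 c6 c7 K_def unfolding admissible_def by blast
  qed
qed

section \<open>Comparison with the error term\<close>

text \<open>The subexponential factors together are at most
  \<open>(n + 1) ^ (5 * r * K) \<le> 2 powr (n / 12)\<close>, and both exponential factors are at
  most \<open>2 powr (5 * n / 6)\<close>. This saves \<open>n / 12\<close> in the exponent, more
  than \<open>n / (26 * log 2 n)\<close>.\<close>

lemma error_terms_le: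
  fixes n r K T :: nat
  assumes r: "r \<ge> 3" and n: "r \<le> n" and K: "K \<ge> 1"
    and T: "real T \<le> 3 * (real n / real r ^ 3)"
    and small: "real (5 * r * K) * ln (real (n + 1)) \<le> real n / 12 * ln 2"
  shows "real (((n + 1) ^ K * r ^ K) * r ^ (3 * T)
    + (r choose 2) * ((((n + 1) ^ K) ^ 3) ^ r * 2 ^ (5 * n div 6)))
    \<le> 2 powr (- (real n / (26 * log 2 (real n)))) * 2 ^ n"
proof -
  have R: "real r > 0" using r by simp
  have "real (2 * r * T) = 2 * real r * real T" by simp
  also have "\<dots> \<le> 2 * real r * (3 * (real n / real r ^ 3))" by (rule mult_left_mono[OF T]) simp
  also have "\<dots> = 6 * real n / real r ^ 2" using R by (simp add: power2_eq_square power3_eq_cube)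
  also have "\<dots> \<le> 6 * real n / 3 ^ 2" using r by (intro divide_left_mono power_mono) auto
  also have "\<dots> \<le> 5 * real n / 6" by simp
  finally have rT: "real (2 * r * T) \<le> 5 * real n / 6" .
  have "r ^ (3 * T) = (r ^ 3) ^ T" by (simp add: power_mult)
  also have "\<dots> \<le> (4 ^ r) ^ T" using cube_le_four_power[OF r] by (rule power_mono) simp
  also have "\<dots> = 2 ^ (2 * r * T)" by (simp add: power_mult power2_eq_square)
  finally have "real (r ^ (3 * T)) \<le> real (2 ^ (2 * r * T))" by (rule of_nat_mono)
  also have "\<dots> = 2 powr real (2 * r * T)" by (subst powr_realpow) auto
  also have "\<dots> \<le> 2 powr (5 * real n / 6)" using rT by simp
  finally have b1: "real (r ^ (3 * T)) \<le> 2 powr (5 * real n / 6)" .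
  have "real (2 ^ (5 * n div 6)) = 2 powr real (5 * n div 6)" by (subst powr_realpow) auto
  also have "real (5 * n div 6) \<le> 5 * real n / 6" by linarith
  finally have b2: "real (2 ^ (5 * n div 6)) \<le> 2 powr (5 * real n / 6)" by simp
  let ?N = "n + 1"
  have e1: "?N ^ K * r ^ K + (r choose 2) * ((?N ^ K) ^ 3) ^ r \<le> ?N ^ (5 * r * K)"
  proof -
    have pow: "((?N ^ K) ^ 3) ^ r = ?N ^ (3 * K * r)"
      by (simp only: power_mult[symmetric] mult.commute[of K])
    have "?N ^ K * r ^ K \<le> ?N ^ K * ?N ^ K" using n by (intro mult_left_mono power_mono) auto
    also have "\<dots> = ?N ^ (2 * K)" by (simp add: power_add[symmetric] mult_2)
    also have "\<dots> \<le> ?N ^ (3 * K * r + 2)"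
    proof (rule power_increasing)
      have "3 * K * 1 \<le> 3 * K * r" using r by (intro mult_left_mono) auto
      then show "2 * K \<le> 3 * K * r + 2" by linarith
    qed simp
    finally have 1: "?N ^ K * r ^ K \<le> ?N ^ (3 * K * r + 2)" .
    have "r choose 2 \<le> r ^ 2" by (rule binomial_le_pow) (use r in simp)
    also have "\<dots> \<le> ?N ^ 2" using n by (intro power_mono) auto
    finally have "(r choose 2) * ?N ^ (3 * K * r) \<le> ?N ^ 2 * ?N ^ (3 * K * r)"
      by (rule mult_right_mono) simp
    also have "?N ^ 2 * ?N ^ (3 * K * r) = ?N ^ (3 * K * r + 2)"
      by (simp only: power_add mult.commute)
    finally have 2: "(r choose 2) * ?N ^ (3 * K * r) \<le> ?N ^ (3 * K * r + 2)" .
    have "?N ^ K * r ^ K + (r choose 2) * ((?N ^ K) ^ 3) ^ r \<le> 2 * ?N ^ (3 * K * r + 2)"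
      using add_mono[OF 1 2] unfolding pow by (simp only: mult_2)
    also have "\<dots> \<le> ?N * ?N ^ (3 * K * r + 2)" using n r by (intro mult_right_mono) auto
    also have "\<dots> = ?N ^ (3 * K * r + 3)" by (simp add: eval_nat_numeral)
    also have "\<dots> \<le> ?N ^ (5 * r * K)"
    proof (intro power_increasing)
      have "3 * 1 \<le> r * K" using r K by (intro mult_mono) auto
      then show "3 * K * r + 3 \<le> 5 * r * K" by (simp add: mult.commute)
    qed simp
    finally show ?thesis .
  qed
  have "real (?N ^ (5 * r * K)) = exp (real (5 * r * K) * ln (real ?N))"
    by (subst exp_of_nat_mult) simp
  also have "\<dots> \<le> exp (real n / 12 * ln 2)" using small by simp
  also have "\<dots> = 2 powr (real n / 12)" by (simp add: powr_def)
  finally have b3: "real (?N ^ (5 * r * K)) \<le> 2 powr (real n / 12)" .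
  have "real (((n + 1) ^ K * r ^ K) * r ^ (3 * T)
    + (r choose 2) * ((((n + 1) ^ K) ^ 3) ^ r * 2 ^ (5 * n div 6)))
    = real (?N ^ K * r ^ K) * real (r ^ (3 * T))
      + real ((r choose 2) * ((?N ^ K) ^ 3) ^ r) * real (2 ^ (5 * n div 6))"
    by simp
  also have "\<dots> \<le> real (?N ^ K * r ^ K) * 2 powr (5 * real n / 6)
      + real ((r choose 2) * ((?N ^ K) ^ 3) ^ r) * 2 powr (5 * real n / 6)"
    using b1 b2 by (intro add_mono mult_left_mono) auto
  also have "\<dots> = real (?N ^ K * r ^ K + (r choose 2) * ((?N ^ K) ^ 3) ^ r) * 2 powr (5 * real n / 6)"
    by (simp only: of_nat_add distrib_right)
  also have "\<dots> \<le> real (?N ^ (5 * r * K)) * 2 powr (5 * real n / 6)"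
    using e1 by (intro mult_right_mono of_nat_mono) auto
  also have "\<dots> \<le> 2 powr (real n / 12) * 2 powr (5 * real n / 6)"
    using b3 by (rule mult_right_mono) simp
  also have "\<dots> = 2 powr (11 * real n / 12)" by (simp flip: powr_add)
  also have "\<dots> \<le> 2 powr (real n - real n / (26 * log 2 (real n)))"
  proof -
    have "log 2 2 \<le> log 2 (real n)" using n r by (intro log_mono) auto
    then have "log 2 (real n) \<ge> 1" by simp
    then have "real n / (26 * log 2 (real n)) \<le> real n / 12" by (intro divide_left_mono) auto
    then show ?thesis by simp
  qed
  also have "\<dots> = 2 powr (- (real n / (26 * log 2 (real n)))) * 2 powr real n"
    by (simp flip: powr_add)
  also have "2 powr real n = 2 ^ n" by (rule powr_realpow) simp
  finally show ?thesis .
qed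

text \<open>Each sum expands into monomials in \<open>m\<close> and \<open>L\<close> of degrees at
  most 7 and 2, possibly times \<open>r ^ 3\<close>, with coefficients adding up to at most 13; the
  factor 15 in \<open>K\<close> covers this.\<close>

lemma monomials_le:
  fixes m L r :: nat
  assumes "m > 0" "L > 0" "r > 0" and s: "s = m ^ 5 + 2 * m * (m ^ 3 * L)" and K: "K = 15 * r ^ 3 * m ^ 7 * L ^ 2"
  shows "2 * m * (m ^ 3 * L) + m ^ 7 * L \<le> K" "2 * m * (2 * r ^ 3 * L) \<le> K"
    "m ^ 7 * L + 2 * m * (2 * r ^ 3 * L) * s \<le> K"
proof -
  have X: "m ^ a * L ^ b \<le> m ^ 7 * L ^ 2" if "a \<le> 7" "b \<le> 2" for a b
    using assms(1,2) that by (intro mult_mono power_increasing) auto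
  have Y: "m ^ a * L ^ b \<le> r ^ 3 * (m ^ 7 * L ^ 2)" "r ^ 3 * (m ^ a * L ^ b) \<le> r ^ 3 * (m ^ 7 * L ^ 2)"
    if "a \<le> 7" "b \<le> 2" for a b
  proof -
    have "1 * (m ^ a * L ^ b) \<le> r ^ 3 * (m ^ 7 * L ^ 2)" by (rule mult_mono[OF _ X[OF that]]) (use assms(3) in auto)
    then show "m ^ a * L ^ b \<le> r ^ 3 * (m ^ 7 * L ^ 2)" by simp
    show "r ^ 3 * (m ^ a * L ^ b) \<le> r ^ 3 * (m ^ 7 * L ^ 2)" using X[OF that] by (rule mult_left_mono) simp
  qed
  have K': "K = 15 * (r ^ 3 * (m ^ 7 * L ^ 2))" unfolding K by simp
  have "2 * m * (m ^ 3 * L) + m ^ 7 * L = 2 * (m ^ 4 * L ^ 1) + m ^ 7 * L ^ 1"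
    by (simp add: eval_nat_numeral algebra_simps)
  also have "\<dots> \<le> K" using Y(1)[of 4 1] Y(1)[of 7 1] unfolding K' by linarith
  finally show "2 * m * (m ^ 3 * L) + m ^ 7 * L \<le> K" .
  have "2 * m * (2 * r ^ 3 * L) = 4 * (r ^ 3 * (m ^ 1 * L ^ 1))" by simp
  also have "\<dots> \<le> K" using Y(2)[of 1 1] unfolding K' by linarith
  finally show "2 * m * (2 * r ^ 3 * L) \<le> K" .
  have "m ^ 7 * L + 2 * m * (2 * r ^ 3 * L) * s
      = m ^ 7 * L ^ 1 + 4 * (r ^ 3 * (m ^ 6 * L ^ 1)) + 8 * (r ^ 3 * (m ^ 5 * L ^ 2))"
    unfolding s by (simp add: eval_nat_numeral algebra_simps)
  also have "\<dots> \<le> K" using Y(1)[of 7 1] Y(2)[of 6 1] Y(2)[of 5 2] unfolding K' by linarith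
  finally show "m ^ 7 * L + 2 * m * (2 * r ^ 3 * L) * s \<le> K" .
qed

theorem mainTheorem1:
  shows "\<forall>r::nat. r \<ge> 3 \<longrightarrow> (\<exists>n\<^sub>0::nat. \<forall>n::nat. n > n\<^sub>0 \<longrightarrow>
    (\<forall>A. A \<subseteq> {1..n} \<and> real (card A) \<ge> (1 - 1 / real r ^ 3) * real n \<longrightarrow>
      real (g A r) \<le> real (r choose 2) * 2 ^ card A
        + 2 powr (- (real n / (26 * log 2 (real n)))) * 2 ^ n))"
proof (intro allI impI)
  fix r :: nat
  assume r: "r \<ge> 3"
  obtain n1 where n1: "\<And>n. n \<ge> n1 \<Longrightarrow> \<exists>m L p K. admissible r n m L p K"
    using eventually_admissible[OF r] unfolding eventually_sequentially by blast
  show "\<exists>n\<^sub>0::nat. \<forall>n::nat. n > n\<^sub>0 \<longrightarrow>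
    (\<forall>A. A \<subseteq> {1..n} \<and> real (card A) \<ge> (1 - 1 / real r ^ 3) * real n \<longrightarrow>
      real (g A r) \<le> real (r choose 2) * 2 ^ card A
        + 2 powr (- (real n / (26 * log 2 (real n)))) * 2 ^ n)"
  \<comment> \<open>Besides admissibility, \<open>n > r\<close> is required so that powers of
    \<open>n + 1\<close> absorb \<open>r ^ K\<close> and \<open>r choose 2\<close>.\<close>
  proof (rule exI[of _ "max n1 r"], intro allI impI, elim conjE)
    fix n A
    assume n: "max n1 r < n" and A: "A \<subseteq> {1..n}"
      and cA: "(1 - 1 / real r ^ 3) * real n \<le> real (card A)"
    have "n1 \<le> n" using n by simp
    from n1[OF this] obtain m L p K where
      par: "real (3 * n) < exp (real L)" "n \<le> m ^ 8" "m > 0" "n \<le> 2 * r ^ 3 * p" "p > 0"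
      and le: "real (p + 2 * m * (2 * r ^ 3 * L)) + 2 * (real n / real r ^ 3) \<le> 3 * (real n / real r ^ 3) - 1"
      and K: "K = 15 * r ^ 3 * m ^ 7 * L ^ 2" and L: "L > 0"
      and small: "real (5 * r * K) * ln (real (n + 1)) \<le> real n / 12 * ln 2"
      unfolding admissible_def by (elim exE conjE)
    \<comment> \<open>Rounding down costs less than 1, which the term \<open>- 1\<close> in
      \<open>admissible\<close> has reserved.\<close>
    define T where "T = nat \<lfloor>3 * (real n / real r ^ 3)\<rfloor>"
    have T: "real T \<le> 3 * (real n / real r ^ 3)" "3 * (real n / real r ^ 3) - 1 \<le> real T"
      unfolding T_def by (simp_all add: of_nat_nat)
    have "card A \<le> n" using card_mono[OF _ A] by simp
    then have "real (n - card A) \<le> real n / real r ^ 3" using cA by (simp add: algebra_simps)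
    then have "real (p + 2 * m * (2 * r ^ 3 * L) + 2 * (n - card A)) \<le> real T"
      using le T(2) by linarith
    then have T': "p + 2 * m * (2 * r ^ 3 * L) + 2 * (n - card A) \<le> T" by (simp only: of_nat_le_iff)
    have "r > 0" using r by simp
    have "g A r \<le> (r choose 2) * 2 ^ card A + (((n + 1) ^ K * r ^ K) * r ^ (3 * T)
      + (r choose 2) * ((((n + 1) ^ K) ^ 3) ^ r * 2 ^ (5 * n div 6)))"
      by (rule g_le[OF A r par T' refl monomials_le[OF par(3) L \<open>r > 0\<close> refl K]])
    then have "real (g A r) \<le> real ((r choose 2) * 2 ^ card A) + real (((n + 1) ^ K * r ^ K) * r ^ (3 * T)
      + (r choose 2) * ((((n + 1) ^ K) ^ 3) ^ r * 2 ^ (5 * n div 6)))"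
      by (simp only: of_nat_add[symmetric] of_nat_le_iff)
    also have "\<dots> \<le> real ((r choose 2) * 2 ^ card A)
        + 2 powr (- (real n / (26 * log 2 (real n)))) * 2 ^ n"
    proof (intro add_left_mono error_terms_le[OF r _ _ T(1) small])
      show "r \<le> n" using n by simp
      show "1 \<le> K" unfolding K using par(3) L r by simp
    qed
    finally show "real (g A r) \<le> real (r choose 2) * 2 ^ card A
        + 2 powr (- (real n / (26 * log 2 (real n)))) * 2 ^ n" by simp
  qed
qed

end
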